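(* Suppose $U$, $V$ and $W$ are (real-valued) random variables, and $h(u,v,w)$ is a measurable $\mathbb{R}^k$-valued function. Suppose, moreover, 1. the joint distribution of $(U,V,W)$ is dominated by the Lebesgue measure; 2. for any $(v,w)$, the function $u\mapsto h(u,v,w)f_{U|V,W}(u|v,w)$ is continuous, where $f_{U|V,W}$ denotes the conditional density of $U$ given $(V,W)$; 3. for each component $h_i(u,v,w)$ of $h(u,v,w)$, there is a function $c_i(v,w)\ge0$ such that $$h_i(u,v,w)f_{U|V,W}(u|v,w)\le c_i(v,w)\quad\text{and}\quad E\{c_i(V,W)\}<\infty.$$ Then, for any constants $a,\eta\in\mathbb{R}$, the function $$\epsilon\mapsto E\{h(U,V,W)\,\mathbb{I}(W+U+\epsilon V<a+\epsilon\eta)\}$$ is differentiable at $\epsilon=0$ with derivative $$D_{\epsilon=0}E\{h(U,V,W)\,\mathbb{I}(W+U+\epsilon V<a+\epsilon\eta)\}=E_W\left[f_{U|W}(a-W|W)\,E_V\{(\eta-V)\,h(a-W,V,W)\mid U=a-W,W\}\right].$$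
   Context: $\mathbb{I}(\cdot)$ is the indicator function. $D_{\epsilon=0}$ denotes first taking the derivative with respect to $\epsilon$ and then evaluating it at $\epsilon=0$. $E(\cdot)$ is with respect to the joint distribution of $(U,V,W)$, $E_W(\cdot)$ is with respect to the marginal distribution of $W$, $E_V(\cdot\mid U=a-W,W)$ is with respect to the conditional distribution with density $f_{V|U,W}(v|a-w,w)$, and $f_{U|W}$ is the conditional density of $U$ given $W$.
   Formalization: As printed the claim fails (h=1, U,W normal, V Cauchy, independent). Proved with |h_i| f_{U|V,W} ≤ c_i in place of h_i f_{U|V,W} ≤ c_i, also E{|V| c_i(V,W)} < ∞, existence of the expectations on the left, and finiteness of f_{U|W}(a-w|w) for almost every w. *)

theory Defs
  imports "HOL-Probability.Probability"
begin

text \<open>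
  Throughout, \<open>f\<close> is a density of \<open>(U, V, W)\<close> with respect to Lebesgue measure on
  \<open>\<real>\<^sup>3\<close>. The derivative formula evaluates conditional densities on the null set
  \<open>u = a - w\<close>, so the versions have to fit together pointwise. The densities that involve
  integrating out \<open>V\<close> are therefore all built from the one version of the joint density
  \<open>f\<^sub>U\<^sub>|\<^sub>V\<^sub>W(u|v,w) f\<^sub>V\<^sub>W(v,w)\<close>, which agrees with \<open>f\<close> wherever \<open>f\<^sub>V\<^sub>W(v,w) \<noteq> 0\<close>, hence
  almost everywhere. Quotients with denominator \<open>0\<close> are \<open>0\<close>.
\<close>

definition dens_VW :: "(real \<times> real \<times> real \<Rightarrow> real) \<Rightarrow> real \<Rightarrow> real \<Rightarrow> real" where
  "dens_VW f v w = (LINT u|lborel. f (u, v, w))"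

definition dens_W :: "(real \<times> real \<times> real \<Rightarrow> real) \<Rightarrow> real \<Rightarrow> real" where
  "dens_W f w = (LINT v|lborel. dens_VW f v w)"

definition cdens_U_VW :: "(real \<times> real \<times> real \<Rightarrow> real) \<Rightarrow> real \<Rightarrow> real \<Rightarrow> real \<Rightarrow> real" where
  "cdens_U_VW f u v w = f (u, v, w) / dens_VW f v w"

definition dens_UVW :: "(real \<times> real \<times> real \<Rightarrow> real) \<Rightarrow> real \<Rightarrow> real \<Rightarrow> real \<Rightarrow> real" where
  "dens_UVW f u v w = cdens_U_VW f u v w * dens_VW f v w"

definition dens_UW :: "(real \<times> real \<times> real \<Rightarrow> real) \<Rightarrow> real \<Rightarrow> real \<Rightarrow> real" where
  "dens_UW f u w = (LINT v|lborel. dens_UVW f u v w)"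

definition cdens_U_W :: "(real \<times> real \<times> real \<Rightarrow> real) \<Rightarrow> real \<Rightarrow> real \<Rightarrow> real" where
  "cdens_U_W f u w = dens_UW f u w / dens_W f w"

definition cdens_V_UW :: "(real \<times> real \<times> real \<Rightarrow> real) \<Rightarrow> real \<Rightarrow> real \<Rightarrow> real \<Rightarrow> real" where
  "cdens_V_UW f v u w = dens_UVW f u v w / dens_UW f u w"

text \<open>\<open>cexp_V f u w g\<close> is \<open>E\<^sub>V{g(V) | U = u, W = w}\<close>.\<close>

definition cexp_V ::
  "(real \<times> real \<times> real \<Rightarrow> real) \<Rightarrow> real \<Rightarrow> real \<Rightarrow> (real \<Rightarrow> 'b::{banach, second_countable_topology}) \<Rightarrow> 'b"
  where
  "cexp_V f u w g = (LINT v|density lborel (\<lambda>v. ennreal (cdens_V_UW f v u w)). g v)"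

end

theory Submission
  imports Defs
begin

text \<open>
  Conditionally on \<open>(V, W) = (v, w)\<close> only the threshold \<open>u < a - w + \<epsilon>(\<eta> - v)\<close> depends on \<open>\<epsilon>\<close>.
  Substituting \<open>u = a - w + \<epsilon>s\<close> turns the difference quotient of the inner integral into the integral
  of \<open>h(a - w + \<epsilon>s, v, w) f\<^sub>U\<^sub>|\<^sub>V\<^sub>W(a - w + \<epsilon>s|v, w)\<close> over the fixed oriented interval from \<open>0\<close> to
  \<open>\<eta> - v\<close>. By continuity in \<open>u\<close> and dominated convergence, first in \<open>s\<close> and then in \<open>(v, w)\<close>,
  the derivative is the integral of
  \<open>(\<eta> - v) h(a - w, v, w) f\<^sub>U\<^sub>|\<^sub>V\<^sub>W(a - w|v, w) f\<^sub>V\<^sub>W(v, w)\<close>, and expanding the conditional densities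
  identifies it with the stated expectation.
\<close>

section \<open>Integration against the signed indicator of an oriented interval\<close>

text \<open>The signed indicator of the oriented interval from \<open>0\<close> to \<open>d\<close>.\<close>

definition step_diff :: "real \<Rightarrow> real \<Rightarrow> real" where
  "step_diff d s = of_bool (s < d) - of_bool (s < 0)"

lemma step_diff_eq_indicator:
  "step_diff d = (\<lambda>s. indicator {0..<d} s - indicator {d..<0} s)"
  by (auto simp: step_diff_def fun_eq_iff indicator_def)

lemma abs_step_diff_eq_indicator:
  "\<bar>step_diff d s\<bar> = indicator {0..<d} s + indicator {d..<0} s"
  by (auto simp: step_diff_def indicator_def)

text \<open>At most one of the two intervals is nonempty: the first for positive \<open>d\<close>,
  the second for negative \<open>d\<close>. So the difference of their lengths is \<open>d\<close>
  itself, sign included.\<close>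

lemma has_bochner_integral_step_diff: "has_bochner_integral lborel (step_diff d) d"
proof -
  have "has_bochner_integral lborel (\<lambda>s. indicator {0..<d} s - indicator {d..<0} s :: real)
      (measure lborel {0..<d} - measure lborel {d..<0})"
    by (intro has_bochner_integral_diff has_bochner_integral_real_indicator)
      (cases "0 \<le> d"; simp)+
  moreover have "measure lborel {0..<d} - measure lborel {d..<0} = d"
    by (cases "0 \<le> d") (auto simp: measure_lborel_Ico)
  ultimately show ?thesis
    by (simp add: step_diff_eq_indicator)
qed

lemma has_bochner_integral_abs_step_diff:
  "has_bochner_integral lborel (\<lambda>s. \<bar>step_diff d s\<bar>) \<bar>d\<bar>"
proof -
  have "has_bochner_integral lborel (\<lambda>s. indicator {0..<d} s + indicator {d..<0} s :: real)
      (measure lborel {0..<d} + measure lborel {d..<0})"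
    by (intro has_bochner_integral_add has_bochner_integral_real_indicator)
      (cases "0 \<le> d"; simp)+
  moreover have "measure lborel {0..<d} + measure lborel {d..<0} = \<bar>d\<bar>"
    by (cases "0 \<le> d") (auto simp: measure_lborel_Ico)
  ultimately show ?thesis
    by (simp add: abs_step_diff_eq_indicator)
qed

lemma measurable_step_diff [measurable (raw)]:
  assumes [measurable]: "d \<in> borel_measurable M" "s \<in> borel_measurable M"
  shows "(\<lambda>x. step_diff (d x) (s x)) \<in> borel_measurable M"
  unfolding step_diff_def by measurable

text \<open>The absolute value of \<open>step_diff d\<close> integrates to the length
  \<open>\<bar>d\<bar>\<close>. Measurability of \<open>g\<close> is not assumed: a non-integrable
  integrand has integral 0, which satisfies the bound because \<open>C\<close> is
  nonnegative.\<close>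

lemma norm_integral_step_diff_le:
  fixes g :: "real \<Rightarrow> 'b::{banach, second_countable_topology}"
  assumes bound: "\<And>s. norm (g s) \<le> C"
  shows "norm (LINT s|lborel. step_diff d s *\<^sub>R g s) \<le> \<bar>d\<bar> * C"
proof -
  have "norm (LINT s|lborel. step_diff d s *\<^sub>R g s)
      \<le> (LINT s|lborel. norm (step_diff d s *\<^sub>R g s))"
    by (rule integral_norm_bound)
  also have "\<dots> \<le> (LINT s|lborel. \<bar>step_diff d s\<bar> * C)"
  proof (rule integral_mono')
    show "integrable lborel (\<lambda>s. \<bar>step_diff d s\<bar> * C)"
      using has_bochner_integral_abs_step_diff[of d] by (simp add: has_bochner_integral_iff)
    show "norm (step_diff d s *\<^sub>R g s) \<le> \<bar>step_diff d s\<bar> * C" for s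
      using bound[of s] by (simp add: mult_left_mono)
    show "0 \<le> \<bar>step_diff d s\<bar> * C" for s
      using order_trans[OF norm_ge_zero bound[of s]] by simp
  qed
  also have "\<dots> = \<bar>d\<bar> * C"
    using has_bochner_integral_abs_step_diff[of d] by (simp add: has_bochner_integral_iff)
  finally show ?thesis .
qed

text \<open>After the substitution the region of integration no longer moves with \<open>n\<close>,
  so \<open>C\<close> on that bounded interval dominates. Pointwise, continuity of \<open>g\<close>
  at \<open>b\<close> gives the constant \<open>g b\<close>, whose integral is the signed length
  times \<open>g b\<close>.\<close>

lemma tendsto_integral_step_diff:
  fixes g :: "real \<Rightarrow> 'b::{banach, second_countable_topology}"
  assumes cont: "continuous_on UNIV g"
    and bound: "\<And>u. norm (g u) \<le> C"
    and X: "X \<longlonglongrightarrow> 0"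
  shows "(\<lambda>n. LINT s|lborel. step_diff d s *\<^sub>R g (b + X n * s)) \<longlonglongrightarrow> d *\<^sub>R g b"
proof -
  have [measurable]: "g \<in> borel_measurable borel"
    by (rule borel_measurable_continuous_onI[OF cont])
  have "(\<lambda>n. LINT s|lborel. step_diff d s *\<^sub>R g (b + X n * s))
      \<longlonglongrightarrow> (LINT s|lborel. step_diff d s *\<^sub>R g b)"
  proof (rule integral_dominated_convergence[where w = "\<lambda>s. \<bar>step_diff d s\<bar> * C"])
    show "integrable lborel (\<lambda>s. \<bar>step_diff d s\<bar> * C)"
      using has_bochner_integral_abs_step_diff[of d] by (simp add: has_bochner_integral_iff)
    have "(\<lambda>n. step_diff d s *\<^sub>R g (b + X n * s)) \<longlonglongrightarrow> step_diff d s *\<^sub>R g b" for s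
    proof -
      have "(\<lambda>n. b + X n * s) \<longlonglongrightarrow> b"
        using tendsto_add[OF tendsto_const tendsto_mult_left_zero[OF X], of b s] by simp
      moreover have "isCont g b"
        using cont by (simp add: continuous_on_eq_continuous_at)
      ultimately show ?thesis
        by (rule tendsto_scaleR[OF tendsto_const isCont_tendsto_compose[rotated]])
    qed
    then show "AE s in lborel. (\<lambda>n. step_diff d s *\<^sub>R g (b + X n * s))
        \<longlonglongrightarrow> step_diff d s *\<^sub>R g b"
      by simp
    show "AE s in lborel. norm (step_diff d s *\<^sub>R g (b + X n * s)) \<le> \<bar>step_diff d s\<bar> * C" for n
      by (intro AE_I2) (simp add: bound mult_left_mono)
    show "(\<lambda>s. step_diff d s *\<^sub>R g b) \<in> borel_measurable lborel"
      by measurable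
    show "(\<lambda>s. step_diff d s *\<^sub>R g (b + X n * s)) \<in> borel_measurable lborel" for n
      by measurable
  qed
  then show ?thesis
    using has_bochner_integral_step_diff[of d] by (simp add: has_bochner_integral_iff)
qed

text \<open>The substitution u = b + e s has Jacobian |e|. For negative \<open>e\<close> the
  inequalities reverse, which contributes the sign of \<open>e\<close>; together they give the
  factor \<open>e\<close>.\<close>

lemma integral_threshold_diff:
  fixes g :: "real \<Rightarrow> 'b::{banach, second_countable_topology}"
  assumes [measurable]: "g \<in> borel_measurable borel" and e: "e \<noteq> 0"
  shows "(LINT u|lborel. (of_bool (u < b + e * d) - of_bool (u < b)) *\<^sub>R g u)
    = e *\<^sub>R (LINT s|lborel. step_diff d s *\<^sub>R g (b + e * s))"
proof -
  have "(LINT u|lborel. (of_bool (u < b + e * d) - of_bool (u < b)) *\<^sub>R g u)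
      = \<bar>e\<bar> *\<^sub>R (LINT s|lborel. (of_bool (b + e * s < b + e * d) - of_bool (b + e * s < b))
          *\<^sub>R g (b + e * s))"
    by (subst lborel_integral_real_affine[OF e, where t = b]) simp
  also have "(LINT s|lborel. (of_bool (b + e * s < b + e * d) - of_bool (b + e * s < b))
          *\<^sub>R g (b + e * s))
      = (LINT s|lborel. sgn e *\<^sub>R step_diff d s *\<^sub>R g (b + e * s))"
  proof (rule integral_cong_AE)
    \<comment> \<open>For negative \<open>e\<close> the reversed strict inequalities have
      complements with \<le> where \<open>step_diff\<close> has <, so the two sides may differ at
      the endpoints 0 and \<open>d\<close>.\<close>
    have "AE s in lborel. s \<noteq> 0 \<and> s \<noteq> d"
      using AE_lborel_singleton[of 0] AE_lborel_singleton[of d] by eventually_elim simp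
    then show "AE s in lborel. (of_bool (b + e * s < b + e * d) - of_bool (b + e * s < b))
        *\<^sub>R g (b + e * s) = sgn e *\<^sub>R step_diff d s *\<^sub>R g (b + e * s)"
      by eventually_elim
        (use e in \<open>auto simp: step_diff_def sgn_if mult_less_cancel_left mult_less_0_iff\<close>)
  qed measurable
  finally show ?thesis
    by (simp add: abs_mult_sgn del: scaleR_scaleR) (simp add: abs_mult_sgn)
qed

section \<open>Measurability and nonnegativity of the densities\<close>

lemma measurable_dens_VW [measurable]:
  assumes [measurable]: "f \<in> borel_measurable borel"
  shows "(\<lambda>(v, w). dens_VW f v w) \<in> borel_measurable (borel :: (real \<times> real) measure)"
proof -
  have "(\<lambda>(v, w). LINT u|lborel. f (u, v, w)) \<in> borel_measurable (borel \<Otimes>\<^sub>M borel)"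
    by measurable
  then show ?thesis
    by (simp add: dens_VW_def borel_prod)
qed

lemma measurable_dens_VW' [measurable (raw)]:
  assumes "f \<in> borel_measurable borel"
    and [measurable]: "v \<in> borel_measurable M" "w \<in> borel_measurable M"
  shows "(\<lambda>x. dens_VW f (v x) (w x)) \<in> borel_measurable M"
proof -
  note measurable_dens_VW[OF assms(1), measurable]
  have "(\<lambda>x. case (v x, w x) of (v, w) \<Rightarrow> dens_VW f v w) \<in> borel_measurable M"
    by measurable
  then show ?thesis by simp
qed

lemma measurable_dens_W [measurable]:
  assumes [measurable]: "f \<in> borel_measurable borel"
  shows "dens_W f \<in> borel_measurable borel"
  unfolding dens_W_def[abs_def] by measurable

lemma measurable_cdens_U_VW [measurable (raw)]:
  assumes [measurable]: "f \<in> borel_measurable borel"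
    "u \<in> borel_measurable M" "v \<in> borel_measurable M" "w \<in> borel_measurable M"
  shows "(\<lambda>x. cdens_U_VW f (u x) (v x) (w x)) \<in> borel_measurable M"
  unfolding cdens_U_VW_def by measurable

lemma measurable_dens_UVW [measurable (raw)]:
  assumes [measurable]: "f \<in> borel_measurable borel"
    "u \<in> borel_measurable M" "v \<in> borel_measurable M" "w \<in> borel_measurable M"
  shows "(\<lambda>x. dens_UVW f (u x) (v x) (w x)) \<in> borel_measurable M"
  unfolding dens_UVW_def by measurable

lemma measurable_dens_UW [measurable (raw)]:
  assumes [measurable]: "f \<in> borel_measurable borel"
    "u \<in> borel_measurable M" "w \<in> borel_measurable M"
  shows "(\<lambda>x. dens_UW f (u x) (w x)) \<in> borel_measurable M"
  unfolding dens_UW_def by measurable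

lemma dens_VW_nonneg: "(\<And>x. 0 \<le> f x) \<Longrightarrow> 0 \<le> dens_VW f v w"
  by (simp add: dens_VW_def)

lemma dens_W_nonneg: "(\<And>x. 0 \<le> f x) \<Longrightarrow> 0 \<le> dens_W f w"
  by (simp add: dens_W_def dens_VW_nonneg)

lemma cdens_U_VW_nonneg: "(\<And>x. 0 \<le> f x) \<Longrightarrow> 0 \<le> cdens_U_VW f u v w"
  by (simp add: cdens_U_VW_def dens_VW_nonneg)

lemma dens_UVW_nonneg: "(\<And>x. 0 \<le> f x) \<Longrightarrow> 0 \<le> dens_UVW f u v w"
  by (simp add: dens_UVW_def cdens_U_VW_nonneg dens_VW_nonneg)

lemma dens_UW_nonneg: "(\<And>x. 0 \<le> f x) \<Longrightarrow> 0 \<le> dens_UW f u w"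
  by (simp add: dens_UW_def dens_UVW_nonneg)

section \<open>Integrable slices and marginal densities\<close>

lemma AE_integrable_slice_VW:
  fixes f :: "'a::euclidean_space \<times> 'b::euclidean_space \<Rightarrow> 'c::{banach, second_countable_topology}"
  assumes "integrable lborel f"
  shows "AE x in lborel. integrable lborel (\<lambda>u. f (u, x))"
  using lborel_pair.AE_integrable_snd[of "\<lambda>u x. f (u, x)"] assms by (simp add: lborel_prod)

lemma integrable_dens_VW:
  assumes "integrable lborel f"
  shows "integrable lborel (\<lambda>(v, w). dens_VW f v w)"
  using lborel_pair.integrable_snd[of "\<lambda>u x. f (u, x)"] assms
  by (simp add: lborel_prod dens_VW_def case_prod_unfold)

lemma AE_integrable_slice_W:
  assumes "integrable lborel f"
  shows "AE w in lborel. integrable lborel (\<lambda>v. dens_VW f v w)"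
  using lborel_pair.AE_integrable_snd[of "dens_VW f"] integrable_dens_VW[OF assms]
  by (simp add: lborel_prod)

text \<open>Where \<open>dens_VW\<close> is nonzero, it cancels. Where it is 0 and the slice is
  integrable, a nonnegative function has integral 0, so it vanishes for almost every u, as does
  \<open>dens_UVW\<close>. Slices that are not integrable occur only on a null set of (v,
  w).\<close>

lemma AE_eq_dens_UVW:
  assumes int: "integrable lborel f" and nonneg: "\<And>x. 0 \<le> f x"
  shows "AE (v, w) in lborel. AE u in lborel. f (u, v, w) = dens_UVW f u v w"
proof -
  have "AE x in lborel. AE u in lborel. f (u, x) = dens_UVW f u (fst x) (snd x)"
    using AE_integrable_slice_VW[OF int]
  proof eventually_elim
    case (elim x)
    show ?case
    proof (cases "dens_VW f (fst x) (snd x) = 0")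
      case True
      then have "AE u in lborel. f (u, x) = 0"
        using elim nonneg by (simp add: dens_VW_def integral_nonneg_eq_0_iff_AE)
      then show ?thesis
        by eventually_elim (simp add: dens_UVW_def True)
    qed (simp add: dens_UVW_def cdens_U_VW_def)
  qed
  then show ?thesis
    by (simp add: case_prod_unfold)
qed

text \<open>The marginal density is at first a nonnegative integral with values in
  \<open>ennreal\<close>. It agrees with the real integral \<open>dens_VW\<close> wherever the slice
  is integrable, hence almost everywhere, which suffices for a density.\<close>

lemma distributed_dens_VW:
  assumes "prob_space M"
    and dist: "distributed M lborel (\<lambda>\<omega>. (U \<omega>, V \<omega>, W \<omega>)) (\<lambda>x. ennreal (f x))"
    and int: "integrable lborel f" and nonneg: "\<And>x. 0 \<le> f x"
  shows "distributed M lborel (\<lambda>\<omega>. (V \<omega>, W \<omega>)) (\<lambda>(v, w). ennreal (dens_VW f v w))"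
proof -
  interpret prob_space M by fact
  have [measurable]: "f \<in> borel_measurable borel"
    using borel_measurable_integrable[OF int] by simp
  have [measurable]: "(\<lambda>(v, w). ennreal (dens_VW f v w)) \<in> borel_measurable borel"
    using measurable_compose[OF measurable_dens_VW measurable_ennreal, of f]
    by (simp add: case_prod_unfold)
  have "distributed M lborel (\<lambda>\<omega>. (V \<omega>, W \<omega>)) (\<lambda>x. \<integral>\<^sup>+u. ennreal (f (u, x)) \<partial>lborel)"
    by (rule distr_marginal2[where S = lborel and X = U])
      (use dist in \<open>auto simp: lborel_prod lborel.sigma_finite_measure_axioms\<close>)
  moreover have "AE x in lborel. (\<integral>\<^sup>+u. ennreal (f (u, x)) \<partial>lborel)
      = (case x of (v, w) \<Rightarrow> ennreal (dens_VW f v w))"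
    using AE_integrable_slice_VW[OF int]
    by eventually_elim (use nonneg in \<open>auto simp: dens_VW_def nn_integral_eq_integral\<close>)
  ultimately show ?thesis
    by (subst distributed_cong_density[symmetric]) (auto dest: distributed_borel_measurable)
qed

lemma distributed_dens_W:
  assumes "prob_space M"
    and dist: "distributed M lborel (\<lambda>\<omega>. (U \<omega>, V \<omega>, W \<omega>)) (\<lambda>x. ennreal (f x))"
    and int: "integrable lborel f" and nonneg: "\<And>x. 0 \<le> f x"
  shows "distributed M lborel W (\<lambda>w. ennreal (dens_W f w))"
proof -
  interpret prob_space M by fact
  have [measurable]: "f \<in> borel_measurable borel"
    using borel_measurable_integrable[OF int] by simp
  have "distributed M lborel W (\<lambda>w. \<integral>\<^sup>+v. ennreal (dens_VW f v w) \<partial>lborel)"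
    using distr_marginal2[of lborel lborel V W "\<lambda>(v, w). ennreal (dens_VW f v w)"]
      distributed_dens_VW[OF assms]
    by (auto simp: lborel_prod lborel.sigma_finite_measure_axioms)
  moreover have "AE w in lborel. (\<integral>\<^sup>+v. ennreal (dens_VW f v w) \<partial>lborel) = ennreal (dens_W f w)"
    using AE_integrable_slice_W[OF int]
    by eventually_elim (use nonneg in \<open>auto simp: dens_W_def dens_VW_nonneg nn_integral_eq_integral\<close>)
  ultimately show ?thesis
    by (subst distributed_cong_density[symmetric]) (auto dest: distributed_borel_measurable)
qed

section \<open>Cancellation of conditional densities and limits under the integral over (v,
  w)\<close>

lemma measurable_curry2:
  fixes c :: "real \<Rightarrow> real \<Rightarrow> 'b::topological_space"
  assumes c: "(\<lambda>(v, w). c v w) \<in> borel_measurable borel"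
    and [measurable]: "v \<in> borel_measurable M" "w \<in> borel_measurable M"
  shows "(\<lambda>x. c (v x) (w x)) \<in> borel_measurable M"
proof -
  have "(\<lambda>x. (v x, w x)) \<in> borel_measurable M"
    by measurable
  from measurable_compose[OF this c] show ?thesis
    by simp
qed

text \<open>The factors \<open>dens_W\<close> and \<open>dens_UW\<close> cancel when nonzero. If
  either is 0, the left side is 0 by the quotient convention or by the factor itself, and
  \<open>dens_UVW\<close> vanishes for almost every v, so the right side is 0 too.\<close>

lemma dens_W_scaleR_cexp_V:
  fixes g :: "real \<Rightarrow> 'b::{banach, second_countable_topology}"
  assumes [measurable]: "f \<in> borel_measurable borel" "g \<in> borel_measurable borel"
    and nonneg: "\<And>x. 0 \<le> f x"
    and int_V: "integrable lborel (\<lambda>v. dens_VW f v w)"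
    and int_UV: "dens_W f w \<noteq> 0 \<Longrightarrow> integrable lborel (\<lambda>v. dens_UVW f u v w)"
  shows "dens_W f w *\<^sub>R (cdens_U_W f u w *\<^sub>R cexp_V f u w g)
    = (LINT v|lborel. dens_UVW f u v w *\<^sub>R g v)"
proof -
  have "cexp_V f u w g = (LINT v|lborel. cdens_V_UW f v u w *\<^sub>R g v)"
    unfolding cexp_V_def cdens_V_UW_def
    by (rule integral_density) (auto simp: nonneg dens_UVW_nonneg dens_UW_nonneg)
  also have "\<dots> = (LINT v|lborel. inverse (dens_UW f u w) *\<^sub>R dens_UVW f u v w *\<^sub>R g v)"
    by (simp add: cdens_V_UW_def divide_inverse_commute)
  finally have cexp: "cexp_V f u w g
      = inverse (dens_UW f u w) *\<^sub>R (LINT v|lborel. dens_UVW f u v w *\<^sub>R g v)"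
    by (simp only: integral_scaleR_right)
  have vanish: "(LINT v|lborel. dens_UVW f u v w *\<^sub>R g v) = 0"
    if "AE v in lborel. dens_UVW f u v w = 0"
    by (rule integral_eq_zero_AE) (use that in eventually_elim, simp)
  show ?thesis
  proof (cases "dens_W f w = 0")
    case True
    then have "AE v in lborel. dens_VW f v w = 0"
      using integral_nonneg_eq_0_iff_AE[OF int_V] nonneg by (simp add: dens_W_def dens_VW_nonneg)
    then have "AE v in lborel. dens_UVW f u v w = 0"
      by eventually_elim (simp add: dens_UVW_def)
    then show ?thesis
      using True by (simp add: vanish)
  next
    case False
    show ?thesis
    proof (cases "dens_UW f u w = 0")
      case True
      \<comment> \<open>Integrability in v matters here: without it \<open>dens_UW\<close> could be
        0 merely as the default value of the integral.\<close>
      then have "AE v in lborel. dens_UVW f u v w = 0"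
        using integral_nonneg_eq_0_iff_AE[OF int_UV[OF False]] nonneg
        by (simp add: dens_UW_def dens_UVW_nonneg)
      then show ?thesis
        by (simp add: vanish cexp)
    qed (use False in \<open>simp add: cexp cdens_U_W_def\<close>)
  qed
qed

text \<open>This is the outer dominated convergence. It is meant for x = (v, w), with
  \<open>p\<close> the density of (V, W), \<open>b\<close> the threshold a - w and \<open>d\<close>
  the shift \<eta> - v; the bound on the inner integral supplies the dominating function.\<close>

lemma tendsto_integral_threshold:
  fixes g :: "real \<Rightarrow> 'x \<Rightarrow> 'b::{banach, second_countable_topology}"
  assumes [measurable]: "(\<lambda>(u, x). g u x) \<in> borel_measurable (borel \<Otimes>\<^sub>M N)"
    "p \<in> borel_measurable N" "b \<in> borel_measurable N" "d \<in> borel_measurable N"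
    and cont: "\<And>x. continuous_on UNIV (\<lambda>u. g u x)"
    and bound: "\<And>u x. norm (g u x) \<le> C x"
    and nonneg: "\<And>x. 0 \<le> p x"
    and int: "integrable N (\<lambda>x. p x * (\<bar>d x\<bar> * C x))"
    and X: "X \<longlonglongrightarrow> 0"
  shows "(\<lambda>n. LINT x|N. p x *\<^sub>R (LINT s|lborel. step_diff (d x) s *\<^sub>R g (b x + X n * s) x))
    \<longlonglongrightarrow> (LINT x|N. p x *\<^sub>R d x *\<^sub>R g (b x) x)"
proof (rule integral_dominated_convergence[OF _ _ int])
  show "AE x in N. (\<lambda>n. p x *\<^sub>R (LINT s|lborel. step_diff (d x) s *\<^sub>R g (b x + X n * s) x))
      \<longlonglongrightarrow> p x *\<^sub>R d x *\<^sub>R g (b x) x"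
    using tendsto_scaleR[OF tendsto_const tendsto_integral_step_diff[OF cont bound X]] by simp
  show "AE x in N. norm (p x *\<^sub>R (LINT s|lborel. step_diff (d x) s *\<^sub>R g (b x + X n * s) x))
      \<le> p x * (\<bar>d x\<bar> * C x)" for n
    using norm_integral_step_diff_le[OF bound] nonneg by (simp add: mult_left_mono)
  show "(\<lambda>x. p x *\<^sub>R d x *\<^sub>R g (b x) x) \<in> borel_measurable N"
    by measurable
  show "(\<lambda>x. p x *\<^sub>R (LINT s|lborel. step_diff (d x) s *\<^sub>R g (b x + X n * s) x))
      \<in> borel_measurable N" for n
    by measurable
qed

section \<open>The joint integral of a difference of two thresholds\<close>

lemma measurable_curry3:
  fixes h :: "real \<Rightarrow> real \<Rightarrow> real \<Rightarrow> 'b::topological_space"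
  assumes h: "(\<lambda>(u, v, w). h u v w) \<in> borel_measurable borel"
    and [measurable]: "u \<in> borel_measurable M" "v \<in> borel_measurable M" "w \<in> borel_measurable M"
  shows "(\<lambda>x. h (u x) (v x) (w x)) \<in> borel_measurable M"
proof -
  have "(\<lambda>x. (u x, v x, w x)) \<in> borel_measurable M"
    by measurable
  from measurable_compose[OF this h] show ?thesis
    by simp
qed

text \<open>By Fubini, u is integrated first. For fixed (v, w) both events are half-lines in u, with
  endpoints a - w + e(\<eta> - v) and a - w, so the one-dimensional substitution applies.\<close>

lemma integral_joint_threshold_diff:
  fixes h :: "real \<Rightarrow> real \<Rightarrow> real \<Rightarrow> 'b::{banach, second_countable_topology}"
  assumes int: "integrable lborel f" and nonneg: "\<And>x. 0 \<le> f x"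
    and h: "(\<lambda>(u, v, w). h u v w) \<in> borel_measurable borel"
    and e: "e \<noteq> 0"
    and int_diff: "integrable lborel (\<lambda>(u, v, w). f (u, v, w) *\<^sub>R
      (of_bool (w + u + e * v < a + e * \<eta>) - of_bool (w + u < a)) *\<^sub>R h u v w)"
  shows "(LINT (u, v, w)|lborel. f (u, v, w) *\<^sub>R
      (of_bool (w + u + e * v < a + e * \<eta>) - of_bool (w + u < a)) *\<^sub>R h u v w)
    = e *\<^sub>R (LINT (v, w)|lborel. dens_VW f v w *\<^sub>R (LINT s|lborel. step_diff (\<eta> - v) s *\<^sub>R
        (cdens_U_VW f (a - w + e * s) v w *\<^sub>R h (a - w + e * s) v w)))"
proof -
  have [measurable]: "f \<in> borel_measurable borel"
    using borel_measurable_integrable[OF int] by simp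
  note measurable_curry3[OF h, measurable (raw)]
  \<comment> \<open>The slice identity is asserted only where \<open>f\<close> equals
    \<open>dens_UVW\<close> for almost every u, that is, for almost every (v, w). There the factor
    \<open>dens_VW\<close> leaves the integral over u.\<close>
  have slice: "(LINT u|lborel. f (u, x) *\<^sub>R
        (of_bool (snd x + u + e * fst x < a + e * \<eta>) - of_bool (snd x + u < a))
          *\<^sub>R h u (fst x) (snd x))
      = e *\<^sub>R dens_VW f (fst x) (snd x) *\<^sub>R (LINT s|lborel. step_diff (\<eta> - fst x) s *\<^sub>R
        (cdens_U_VW f (a - snd x + e * s) (fst x) (snd x) *\<^sub>R h (a - snd x + e * s) (fst x) (snd x)))"
    (is "?L = ?R")
    if AE: "AE u in lborel. f (u, x) = dens_UVW f u (fst x) (snd x)" for x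
  proof -
    obtain v w where x: "x = (v, w)" by fastforce
    let ?g = "\<lambda>u. cdens_U_VW f u v w *\<^sub>R h u v w"
    have g: "?g \<in> borel_measurable borel"
      by measurable
    have "?L = (LINT u|lborel. dens_VW f v w *\<^sub>R
        (of_bool (u < (a - w) + e * (\<eta> - v)) - of_bool (u < a - w)) *\<^sub>R ?g u)"
    proof (rule integral_cong_AE)
      have 1: "(w + u + e * v < a + e * \<eta>) = (u < (a - w) + e * (\<eta> - v))" for u
        by (auto simp: algebra_simps)
      have 2: "(w + u < a) = (u < a - w)" for u
        by auto
      show "AE u in lborel. f (u, x) *\<^sub>R
          (of_bool (snd x + u + e * fst x < a + e * \<eta>) - of_bool (snd x + u < a))
            *\<^sub>R h u (fst x) (snd x)
          = dens_VW f v w *\<^sub>R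
            (of_bool (u < (a - w) + e * (\<eta> - v)) - of_bool (u < a - w)) *\<^sub>R ?g u"
        using AE by eventually_elim (simp only: x fst_conv snd_conv 1 2 dens_UVW_def, simp add: mult_ac)
      show "(\<lambda>u. f (u, x) *\<^sub>R
          (of_bool (snd x + u + e * fst x < a + e * \<eta>) - of_bool (snd x + u < a))
            *\<^sub>R h u (fst x) (snd x)) \<in> borel_measurable lborel"
        unfolding x fst_conv snd_conv by measurable
      show "(\<lambda>u. dens_VW f v w *\<^sub>R
          (of_bool (u < (a - w) + e * (\<eta> - v)) - of_bool (u < a - w)) *\<^sub>R ?g u)
            \<in> borel_measurable lborel"
        by measurable
    qed
    also have "\<dots> = dens_VW f v w *\<^sub>R (LINT u|lborel.
        (of_bool (u < (a - w) + e * (\<eta> - v)) - of_bool (u < a - w)) *\<^sub>R ?g u)"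
      by (rule integral_scaleR_right)
    also have "\<dots> = dens_VW f v w *\<^sub>R e *\<^sub>R
        (LINT s|lborel. step_diff (\<eta> - v) s *\<^sub>R ?g (a - w + e * s))"
      by (simp only: integral_threshold_diff[OF g e])
    finally show ?thesis
      unfolding x fst_conv snd_conv by (simp only: scaleR_left_commute)
  qed
  have "(LINT (u, v, w)|lborel. f (u, v, w) *\<^sub>R
      (of_bool (w + u + e * v < a + e * \<eta>) - of_bool (w + u < a)) *\<^sub>R h u v w)
    = (LINT x|lborel. LINT u|lborel. f (u, x) *\<^sub>R
        (of_bool (snd x + u + e * fst x < a + e * \<eta>) - of_bool (snd x + u < a))
          *\<^sub>R h u (fst x) (snd x))"
    using lborel_pair.integral_snd[of "\<lambda>u x. f (u, x) *\<^sub>R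
        (of_bool (snd x + u + e * fst x < a + e * \<eta>) - of_bool (snd x + u < a))
          *\<^sub>R h u (fst x) (snd x)"] int_diff
    by (simp add: lborel_prod case_prod_unfold)
  also have "\<dots> = (LINT x|lborel. e *\<^sub>R (dens_VW f (fst x) (snd x) *\<^sub>R
      (LINT s|lborel. step_diff (\<eta> - fst x) s *\<^sub>R
        (cdens_U_VW f (a - snd x + e * s) (fst x) (snd x) *\<^sub>R h (a - snd x + e * s) (fst x) (snd x)))))"
  proof (rule integral_cong_AE)
    show "AE x in lborel. (LINT u|lborel. f (u, x) *\<^sub>R
        (of_bool (snd x + u + e * fst x < a + e * \<eta>) - of_bool (snd x + u < a))
          *\<^sub>R h u (fst x) (snd x))
      = e *\<^sub>R (dens_VW f (fst x) (snd x) *\<^sub>R (LINT s|lborel. step_diff (\<eta> - fst x) s *\<^sub>R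
        (cdens_U_VW f (a - snd x + e * s) (fst x) (snd x) *\<^sub>R h (a - snd x + e * s) (fst x) (snd x))))"
      using AE_eq_dens_UVW[OF int nonneg]
      by eventually_elim (rule slice, simp add: case_prod_unfold)
    have "(\<lambda>x. LINT u|lborel. f (u, fst x, snd x) *\<^sub>R
        (of_bool (snd x + u + e * fst x < a + e * \<eta>) - of_bool (snd x + u < a))
          *\<^sub>R h u (fst x) (snd x)) \<in> borel_measurable (borel \<Otimes>\<^sub>M borel)"
      by measurable
    then show "(\<lambda>x. LINT u|lborel. f (u, x) *\<^sub>R
        (of_bool (snd x + u + e * fst x < a + e * \<eta>) - of_bool (snd x + u < a))
          *\<^sub>R h u (fst x) (snd x)) \<in> borel_measurable lborel"
      by (simp add: borel_prod)
    show "(\<lambda>x. e *\<^sub>R (dens_VW f (fst x) (snd x) *\<^sub>R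
        (LINT s|lborel. step_diff (\<eta> - fst x) s *\<^sub>R
          (cdens_U_VW f (a - snd x + e * s) (fst x) (snd x) *\<^sub>R h (a - snd x + e * s) (fst x) (snd x)))))
        \<in> borel_measurable lborel"
      unfolding lborel_prod[symmetric] by measurable
  qed
  finally show ?thesis
    by (simp only: case_prod_unfold integral_scaleR_right)
qed

text \<open>The form of the hypotheses follows the estimates. The inner difference quotient is
  bounded by |\<eta> - v| times a sum of the functions c, so \<open>domination\<close> controls
  absolute values and includes the moment of |V| c. \<open>lhs_exists\<close> makes each expectation
  a genuine integral and not a default 0. \<open>cond_density_exists\<close> does the same for
  \<open>dens_UW\<close> on the null set u = a - w, which almost-everywhere statements about
  \<open>f\<close> do not reach.\<close>

theorem lemma1:
  fixes M :: "'a measure"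
    and U V W :: "'a \<Rightarrow> real"
    and h :: "real \<Rightarrow> real \<Rightarrow> real \<Rightarrow> real ^ 'k"
    and f :: "real \<times> real \<times> real \<Rightarrow> real"
    and a \<eta> :: real
  assumes "prob_space M"
    and "U \<in> borel_measurable M" "V \<in> borel_measurable M" "W \<in> borel_measurable M"
    and "(\<lambda>(u, v, w). h u v w) \<in> borel_measurable borel"
    and joint_density: "distributed M lborel (\<lambda>\<omega>. (U \<omega>, V \<omega>, W \<omega>)) (\<lambda>x. ennreal (f x))"
    and "\<And>x. 0 \<le> f x"
    and continuity: "\<And>v w. continuous_on UNIV (\<lambda>u. cdens_U_VW f u v w *\<^sub>R h u v w)"
    and domination: "\<And>i. \<exists>c :: real \<Rightarrow> real \<Rightarrow> real.
          (\<lambda>(v, w). c v w) \<in> borel_measurable borel \<and>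
          (\<forall>v w. 0 \<le> c v w) \<and>
          (\<forall>u v w. \<bar>h u v w $ i\<bar> * cdens_U_VW f u v w \<le> c v w) \<and>
          integrable M (\<lambda>\<omega>. c (V \<omega>) (W \<omega>)) \<and>
          integrable M (\<lambda>\<omega>. \<bar>V \<omega>\<bar> * c (V \<omega>) (W \<omega>))"
    and lhs_exists: "\<And>\<epsilon>. integrable M (\<lambda>\<omega>.
          of_bool (W \<omega> + U \<omega> + \<epsilon> * V \<omega> < a + \<epsilon> * \<eta>) *\<^sub>R h (U \<omega>) (V \<omega>) (W \<omega>))"
    and cond_density_exists: "AE w in distr M borel W. integrable lborel (\<lambda>v. dens_UVW f (a - w) v w)"
  shows "((\<lambda>\<epsilon>. LINT \<omega>|M.
            of_bool (W \<omega> + U \<omega> + \<epsilon> * V \<omega> < a + \<epsilon> * \<eta>) *\<^sub>R h (U \<omega>) (V \<omega>) (W \<omega>))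
          has_vector_derivative
          (LINT w|distr M borel W.
            cdens_U_W f (a - w) w *\<^sub>R cexp_V f (a - w) w (\<lambda>v. (\<eta> - v) *\<^sub>R h (a - w) v w)))
         (at 0)"
proof -
  interpret prob_space M by fact
  note [measurable] = \<open>U \<in> borel_measurable M\<close> \<open>V \<in> borel_measurable M\<close> \<open>W \<in> borel_measurable M\<close>
  note nonneg = \<open>\<And>x. 0 \<le> f x\<close>
  have [measurable]: "f \<in> borel_measurable borel"
    using distributed_real_measurable[OF nonneg joint_density] by simp
  note measurable_curry3[OF assms(5), measurable (raw)]
  \<comment> \<open>Integrability of \<open>f\<close> is that of the constant 1 on a probability
    space.\<close>
  have int_f: "integrable lborel f"
    using distributed_integrable[OF joint_density, of "\<lambda>_. 1"] nonneg by simp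

  obtain c where c: "\<forall>i. (\<lambda>(v, w). c i v w) \<in> borel_measurable borel \<and>
      (\<forall>v w. 0 \<le> c i v w) \<and>
      (\<forall>u v w. \<bar>h u v w $ i\<bar> * cdens_U_VW f u v w \<le> c i v w) \<and>
      integrable M (\<lambda>\<omega>. c i (V \<omega>) (W \<omega>)) \<and>
      integrable M (\<lambda>\<omega>. \<bar>V \<omega>\<bar> * c i (V \<omega>) (W \<omega>))"
    using choice[OF allI[OF domination]] by (rule exE)
  have c_meas: "(\<lambda>(v, w). c i v w) \<in> borel_measurable borel"
    and c_bound: "\<bar>h u v w $ i\<bar> * cdens_U_VW f u v w \<le> c i v w"
    and c_int: "integrable M (\<lambda>\<omega>. c i (V \<omega>) (W \<omega>))"
    and c_int': "integrable M (\<lambda>\<omega>. \<bar>V \<omega>\<bar> * c i (V \<omega>) (W \<omega>))" for i u v w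
    using c by blast+
  note measurable_curry2[OF c_meas, measurable (raw)]
  \<comment> \<open>The Euclidean norm is at most the sum of the absolute components, so the sum of
    the componentwise bounds dominates the vector-valued \<open>g\<close> uniformly in u.\<close>
  define C where "C v w = (\<Sum>i\<in>UNIV. c i v w)" for v w
  define g where "g u x = cdens_U_VW f u (fst x) (snd x) *\<^sub>R h u (fst x) (snd x)" for u x
  have g_cont: "continuous_on UNIV (\<lambda>u. g u x)" for x
    unfolding g_def by (rule continuity)
  have g_bound: "norm (g u x) \<le> C (fst x) (snd x)" for u x
  proof -
    have "norm (g u x) \<le> (\<Sum>i\<in>UNIV. \<bar>g u x $ i\<bar>)"
      by (rule norm_le_l1_cart)
    also have "\<dots> \<le> C (fst x) (snd x)"
      unfolding C_def g_def
      by (rule sum_mono)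
        (use c_bound in \<open>simp add: abs_mult cdens_U_VW_nonneg nonneg mult.commute\<close>)
    finally show ?thesis .
  qed

  have C_int: "integrable M (\<lambda>\<omega>. \<bar>\<eta> - V \<omega>\<bar> * C (V \<omega>) (W \<omega>))"
  proof (rule Bochner_Integration.integrable_bound)
    \<comment> \<open>The majorant comes from |\<eta> - v| \<le> |\<eta>| + |v|; both moments in
      \<open>domination\<close> enter.\<close>
    show "integrable M (\<lambda>\<omega>. \<Sum>i\<in>UNIV. \<bar>\<eta>\<bar> * c i (V \<omega>) (W \<omega>) + \<bar>V \<omega>\<bar> * c i (V \<omega>) (W \<omega>))"
      by (intro Bochner_Integration.integrable_sum Bochner_Integration.integrable_add
          integrable_mult_right c_int c_int')
    have C_nonneg: "0 \<le> C v w" for v w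
      using order_trans[OF norm_ge_zero g_bound[of 0 "(v, w)"]] by simp
    have "\<bar>\<eta> - v\<bar> * C v w \<le> (\<Sum>i\<in>UNIV. \<bar>\<eta>\<bar> * c i v w + \<bar>v\<bar> * c i v w)" for v w
    proof -
      have "\<bar>\<eta> - v\<bar> * C v w \<le> (\<bar>\<eta>\<bar> + \<bar>v\<bar>) * C v w"
        by (intro mult_right_mono C_nonneg) simp
      then show ?thesis
        by (simp add: C_def sum_distrib_left sum.distrib distrib_right)
    qed
    then show "AE \<omega> in M. norm (\<bar>\<eta> - V \<omega>\<bar> * C (V \<omega>) (W \<omega>))
        \<le> norm (\<Sum>i\<in>UNIV. \<bar>\<eta>\<bar> * c i (V \<omega>) (W \<omega>) + \<bar>V \<omega>\<bar> * c i (V \<omega>) (W \<omega>))"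
      using C_nonneg by (intro AE_I2) (auto intro: order_trans[OF _ abs_ge_self])
    show "(\<lambda>\<omega>. \<bar>\<eta> - V \<omega>\<bar> * C (V \<omega>) (W \<omega>)) \<in> borel_measurable M"
      unfolding C_def by measurable
  qed
  have pC_int: "integrable lborel (\<lambda>x. dens_VW f (fst x) (snd x) * (\<bar>\<eta> - fst x\<bar> * C (fst x) (snd x)))"
  proof -
    \<comment> \<open>The weight does not involve u, so after passing to the law of (U, V, W),
      integrating out u turns \<open>f\<close> into \<open>dens_VW\<close>.\<close>
    have "(\<lambda>x. \<bar>\<eta> - fst (snd x)\<bar> * C (fst (snd x)) (snd (snd x)))
        \<in> borel_measurable (lborel :: (real \<times> real \<times> real) measure)"
      unfolding C_def lborel_prod[symmetric] by measurable
    from distributed_integrable[OF joint_density this] C_int nonneg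
    have "integrable lborel (\<lambda>x. f x * (\<bar>\<eta> - fst (snd x)\<bar> * C (fst (snd x)) (snd (snd x))))"
      by simp
    then have "integrable lborel (\<lambda>x. LINT u|lborel. f (u, x) * (\<bar>\<eta> - fst x\<bar> * C (fst x) (snd x)))"
      using lborel_pair.integrable_snd[of "\<lambda>u x. f (u, x) * (\<bar>\<eta> - fst x\<bar> * C (fst x) (snd x))"]
      by (simp add: lborel_prod case_prod_unfold)
    then show ?thesis
      by (simp add: dens_VW_def)
  qed

  define \<Phi> where "\<Phi> \<epsilon> = (LINT \<omega>|M.
    of_bool (W \<omega> + U \<omega> + \<epsilon> * V \<omega> < a + \<epsilon> * \<eta>) *\<^sub>R h (U \<omega>) (V \<omega>) (W \<omega>))" for \<epsilon>
  \<comment> \<open>For nonzero \<epsilon> this is the difference quotient of \<open>\<Phi>\<close>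
    at 0, and \<open>D\<close> is its limit.\<close>
  define J where "J \<epsilon> = (LINT x|lborel. dens_VW f (fst x) (snd x) *\<^sub>R
    (LINT s|lborel. step_diff (\<eta> - fst x) s *\<^sub>R g (a - snd x + \<epsilon> * s) x))" for \<epsilon>
  define D where "D = (LINT x|lborel. dens_VW f (fst x) (snd x) *\<^sub>R (\<eta> - fst x) *\<^sub>R g (a - snd x) x)"
  have quotient: "\<Phi> \<epsilon> - \<Phi> 0 = \<epsilon> *\<^sub>R J \<epsilon>" if "\<epsilon> \<noteq> 0" for \<epsilon>
  proof -
    let ?k = "\<lambda>(u, v, w). (of_bool (w + u + \<epsilon> * v < a + \<epsilon> * \<eta>) - of_bool (w + u < a)) *\<^sub>R h u v w"
    let ?Z = "\<lambda>\<omega>. (U \<omega>, V \<omega>, W \<omega>)"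
    have "?k \<in> borel_measurable (borel \<Otimes>\<^sub>M borel \<Otimes>\<^sub>M borel)"
      by measurable
    then have [measurable]: "?k \<in> borel_measurable lborel"
      by (simp add: borel_prod)
    have [measurable]: "?Z \<in> measurable M lborel"
      using distributed_measurable[OF joint_density] .
    have distr: "distr M lborel ?Z = density lborel (\<lambda>x. ennreal (f x))"
      by (rule distributed_distr_eq_density[OF joint_density])
    \<comment> \<open>Existence of the expectations at both \<epsilon> and 0 allows their difference
      to be a single integral.\<close>
    have k_int: "integrable M (\<lambda>\<omega>. ?k (?Z \<omega>))"
      using Bochner_Integration.integrable_diff[OF lhs_exists[of \<epsilon>] lhs_exists[of 0]]
      by (simp add: scaleR_left_diff_distrib)
    have "\<Phi> \<epsilon> - \<Phi> 0 = (LINT \<omega>|M. ?k (?Z \<omega>))"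
      using Bochner_Integration.integral_diff[OF lhs_exists[of \<epsilon>] lhs_exists[of 0]]
      by (simp add: \<Phi>_def scaleR_left_diff_distrib)
    also have "\<dots> = integral\<^sup>L (distr M lborel ?Z) ?k"
      by (rule integral_distr[symmetric]) measurable
    also have "\<dots> = (LINT x|lborel. f x *\<^sub>R ?k x)"
      unfolding distr by (rule integral_density) (auto simp: nonneg)
    finally have diff: "\<Phi> \<epsilon> - \<Phi> 0 = (LINT x|lborel. f x *\<^sub>R ?k x)" .
    have "integrable (distr M lborel ?Z) ?k"
      using k_int by (subst integrable_distr_eq) auto
    then have "integrable lborel (\<lambda>x. f x *\<^sub>R ?k x)"
      unfolding distr by (subst (asm) integrable_density) (auto simp: nonneg)
    then show ?thesis
      using integral_joint_threshold_diff[OF int_f nonneg assms(5) that, of a \<eta>] diff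
      by (simp add: J_def g_def case_prod_unfold)
  qed

  have J_lim: "(\<lambda>n. J (X n)) \<longlonglongrightarrow> D" if "X \<longlonglongrightarrow> 0" for X
    unfolding J_def D_def
  proof (rule tendsto_integral_threshold[where C = "\<lambda>x. C (fst x) (snd x)"])
    show "(\<lambda>(u, x). g u x) \<in> borel_measurable (borel \<Otimes>\<^sub>M lborel)"
      unfolding g_def lborel_prod[symmetric] by measurable
    show "(\<lambda>x. dens_VW f (fst x) (snd x)) \<in> borel_measurable lborel"
      using measurable_dens_VW[of f] by (simp add: case_prod_unfold)
    show "(\<lambda>x :: real \<times> real. a - snd x) \<in> borel_measurable lborel"
      "(\<lambda>x :: real \<times> real. \<eta> - fst x) \<in> borel_measurable lborel"
      unfolding lborel_prod[symmetric] by measurable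
  qed (fact g_cont g_bound dens_VW_nonneg[OF nonneg] pC_int that)+

  \<comment> \<open>Identification of the limit with the stated expectation\<close>
  define R where "R w = cdens_U_W f (a - w) w *\<^sub>R
    cexp_V f (a - w) w (\<lambda>v. (\<eta> - v) *\<^sub>R h (a - w) v w)" for w
  \<comment> \<open>The measure inside \<open>cexp_V\<close> depends on w. Over the fixed measure
    \<open>lborel\<close>, \<open>R\<close> becomes a parametrized integral, and its measurability
    follows.\<close>
  have R_alt: "R w = cdens_U_W f (a - w) w *\<^sub>R
      (LINT v|lborel. cdens_V_UW f v (a - w) w *\<^sub>R (\<eta> - v) *\<^sub>R h (a - w) v w)" for w
    unfolding R_def cexp_V_def
    by (subst integral_density)
      (auto simp: cdens_V_UW_def nonneg dens_UVW_nonneg dens_UW_nonneg)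
  have [measurable]: "R \<in> borel_measurable borel"
    unfolding R_alt[abs_def] cdens_U_W_def cdens_V_UW_def by measurable
  have distr_W: "distr M borel W = density lborel (\<lambda>w. ennreal (dens_W f w))"
    using distributed_distr_eq_density[OF distributed_dens_W[OF \<open>prob_space M\<close> joint_density int_f nonneg]]
      distr_cong[of M M lborel borel W W] by simp
  have D_int: "integrable lborel (\<lambda>x. dens_VW f (fst x) (snd x) *\<^sub>R (\<eta> - fst x) *\<^sub>R g (a - snd x) x)"
  proof (rule Bochner_Integration.integrable_bound[OF pC_int])
    show "(\<lambda>x. dens_VW f (fst x) (snd x) *\<^sub>R (\<eta> - fst x) *\<^sub>R g (a - snd x) x)
        \<in> borel_measurable lborel"
      unfolding g_def lborel_prod[symmetric] by measurable
    show "AE x in lborel. norm (dens_VW f (fst x) (snd x) *\<^sub>R (\<eta> - fst x) *\<^sub>R g (a - snd x) x)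
        \<le> norm (dens_VW f (fst x) (snd x) * (\<bar>\<eta> - fst x\<bar> * C (fst x) (snd x)))"
      using order_trans[OF g_bound abs_ge_self]
      by (intro AE_I2) (simp add: abs_mult mult.assoc mult_left_mono)
  qed
  have "D = (LINT w|lborel. LINT v|lborel. dens_VW f v w *\<^sub>R (\<eta> - v) *\<^sub>R g (a - w) (v, w))"
    using lborel_pair.integral_snd[of "\<lambda>v w. dens_VW f v w *\<^sub>R (\<eta> - v) *\<^sub>R g (a - w) (v, w)"] D_int
    by (simp add: D_def lborel_prod case_prod_unfold)
  also have "\<dots> = (LINT w|lborel. dens_W f w *\<^sub>R R w)"
  proof (rule integral_cong_AE)
    \<comment> \<open>A statement for almost every w under the law of W transfers to Lebesgue
      measure only where \<open>dens_W\<close> is nonzero, which is all the cancellation lemma asks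
      for.\<close>
    have "AE w in lborel. dens_W f w \<noteq> 0 \<longrightarrow> integrable lborel (\<lambda>v. dens_UVW f (a - w) v w)"
    proof -
      have "AE w in lborel. 0 < ennreal (dens_W f w) \<longrightarrow>
          integrable lborel (\<lambda>v. dens_UVW f (a - w) v w)"
        using cond_density_exists unfolding distr_W by (subst (asm) AE_density) simp_all
      then show ?thesis
        by eventually_elim (use dens_W_nonneg[OF nonneg] in \<open>auto simp: less_le\<close>)
    qed
    then show "AE w in lborel. (LINT v|lborel. dens_VW f v w *\<^sub>R (\<eta> - v) *\<^sub>R g (a - w) (v, w))
        = dens_W f w *\<^sub>R R w"
      using AE_integrable_slice_W[OF int_f]
    proof eventually_elim
      case (elim w)
      have "dens_W f w *\<^sub>R R w
          = (LINT v|lborel. dens_UVW f (a - w) v w *\<^sub>R (\<eta> - v) *\<^sub>R h (a - w) v w)"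
        unfolding R_def
        by (rule dens_W_scaleR_cexp_V) (use elim nonneg in \<open>simp_all, measurable\<close>)
      \<comment> \<open>At the fixed point u = a - w, \<open>f\<close> and \<open>dens_UVW\<close>
        may differ. The identity is nevertheless pointwise, since \<open>dens_UVW\<close> is by
        definition the conditional density times \<open>dens_VW\<close>.\<close>
      then show ?case
        by (simp add: g_def dens_UVW_def mult_ac)
    qed
  qed (unfold g_def fst_conv snd_conv, measurable)
  also have "\<dots> = (LINT w|distr M borel W. R w)"
    unfolding distr_W by (rule integral_density[symmetric]) (auto simp: dens_W_nonneg nonneg)
  finally have D_eq: "D = (LINT w|distr M borel W. R w)" .

  \<comment> \<open>Dominated convergence was applied along sequences; sequential limits determine
    the limit at 0.\<close>
  have "(J \<longlongrightarrow> D) (at 0)"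
    unfolding tendsto_at_iff_sequentially using J_lim by (auto simp: comp_def)
  then have J_null: "((\<lambda>\<epsilon>. norm (J \<epsilon> - D)) \<longlongrightarrow> 0) (at 0)"
    by (rule tendsto_norm_zero[OF LIM_zero])
  have "(\<Phi> has_vector_derivative D) (at 0)"
    unfolding has_vector_derivative_def has_derivative_within
  proof
    show "((\<lambda>\<epsilon>. (1 / norm (\<epsilon> - 0)) *\<^sub>R (\<Phi> \<epsilon> - (\<Phi> 0 + (\<epsilon> - 0) *\<^sub>R D))) \<longlongrightarrow> 0) (at 0)"
    \<comment> \<open>The remainder is \<epsilon> (J \<epsilon> - D), so dividing by |\<epsilon>|
      leaves exactly the norm of J \<epsilon> - D.\<close>
    proof (rule Lim_null_comparison[OF _ J_null])
      have "norm ((1 / norm (\<epsilon> - 0)) *\<^sub>R (\<Phi> \<epsilon> - (\<Phi> 0 + (\<epsilon> - 0) *\<^sub>R D))) = norm (J \<epsilon> - D)"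
        if "\<epsilon> \<noteq> 0" for \<epsilon>
      proof -
        have "\<Phi> \<epsilon> - (\<Phi> 0 + (\<epsilon> - 0) *\<^sub>R D) = \<epsilon> *\<^sub>R (J \<epsilon> - D)"
          using quotient[OF that] by (simp add: algebra_simps)
        then show ?thesis
          using that by simp
      qed
      then show "\<forall>\<^sub>F \<epsilon> in at 0. norm ((1 / norm (\<epsilon> - 0)) *\<^sub>R (\<Phi> \<epsilon> - (\<Phi> 0 + (\<epsilon> - 0) *\<^sub>R D)))
          \<le> norm (J \<epsilon> - D)"
        by (auto simp: eventually_at_filter)
    qed
  qed (rule bounded_linear_scaleR_left)
  then show ?thesis
    unfolding \<Phi>_def D_eq R_def .
qed

end
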